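(* $\mathrm{Diff}^{\infty}(\mathbf{R})$ contains nilpotent subgroups of every degree of nilpotency; that is, for every integer $n\ge 1$ there is a nilpotent subgroup of $\mathrm{Diff}^\infty(\mathbf{R})$ whose degree of nilpotency is exactly $n$.
   Context: $\mathrm{Diff}^{\infty}(\mathbf{R})$ denotes the group of orientation-preserving $C^\infty$ diffeomorphisms of the real line, under composition. The degree of nilpotency of a nilpotent group is its nilpotency class. *)

theory Defs
  imports "HOL-Analysis.Analysis" "HOL-Algebra.Generated_Groups"
begin

text \<open>Every iterate of the total operator \<^const>\<open>deriv\<close> is required to be differentiable,
  so each iterate is a genuine derivative of the previous one.\<close>

definition smooth :: "(real \<Rightarrow> real) \<Rightarrow> bool" where
  "smooth f \<longleftrightarrow> (\<forall>k x. (deriv ^^ k) f differentiable (at x))"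

definition diff_upto :: "nat \<Rightarrow> (real \<Rightarrow> real) \<Rightarrow> bool" where
  "diff_upto n f \<longleftrightarrow> (\<forall>k<n. \<forall>x. (deriv ^^ k) f differentiable (at x))"

lemma smooth_iff_diff_upto: "smooth f \<longleftrightarrow> (\<forall>n. diff_upto n f)"
  unfolding smooth_def diff_upto_def by blast

lemma diff_upto_0 [simp]: "diff_upto 0 f"
  by (simp add: diff_upto_def)

lemma diff_upto_Suc:
  "diff_upto (Suc n) f \<longleftrightarrow> (\<forall>x. f differentiable (at x)) \<and> diff_upto n (deriv f)"
  unfolding diff_upto_def All_less_Suc2 by (simp add: funpow_swap1)

lemma diff_upto_mono: "diff_upto n f \<Longrightarrow> m \<le> n \<Longrightarrow> diff_upto m f"
  by (auto simp: diff_upto_def)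

lemma has_deriv: "f differentiable (at x) \<Longrightarrow> (f has_real_derivative deriv f x) (at x)"
  by (metis DERIV_deriv_iff_real_differentiable)

lemma diff_upto_add:
  "diff_upto n f \<Longrightarrow> diff_upto n g \<Longrightarrow> diff_upto n (\<lambda>x. f x + g x)"
proof (induction n arbitrary: f g)
  case (Suc n)
  have d: "((\<lambda>x. f x + g x) has_real_derivative deriv f x + deriv g x) (at x)" for x
    using Suc.prems by (intro DERIV_add has_deriv) (auto simp: diff_upto_Suc)
  have "deriv (\<lambda>x. f x + g x) = (\<lambda>x. deriv f x + deriv g x)"
    by (rule ext) (rule DERIV_imp_deriv[OF d])
  then show ?case
    using Suc d by (auto simp: diff_upto_Suc real_differentiable_def)
qed simp

lemma diff_upto_mult:
  "diff_upto n f \<Longrightarrow> diff_upto n g \<Longrightarrow> diff_upto n (\<lambda>x. f x * g x)"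
proof (induction n arbitrary: f g)
  case (Suc n)
  have d: "((\<lambda>x. f x * g x) has_real_derivative deriv f x * g x + deriv g x * f x) (at x)" for x
    using Suc.prems by (intro DERIV_mult has_deriv) (auto simp: diff_upto_Suc)
  have e: "deriv (\<lambda>x. f x * g x) = (\<lambda>x. deriv f x * g x + deriv g x * f x)"
    by (rule ext) (rule DERIV_imp_deriv[OF d])
  have "diff_upto n f" "diff_upto n g" "diff_upto n (deriv f)" "diff_upto n (deriv g)"
    using Suc.prems diff_upto_mono[of "Suc n" _ n] by (auto simp: diff_upto_Suc)
  then have "diff_upto n (deriv (\<lambda>x. f x * g x))"
    unfolding e by (intro diff_upto_add Suc.IH)
  then show ?case
    using d by (auto simp: diff_upto_Suc real_differentiable_def)
qed simp

lemma diff_upto_comp: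
  "diff_upto n f \<Longrightarrow> diff_upto n g \<Longrightarrow> diff_upto n (f \<circ> g)"
proof (induction n arbitrary: f)
  case (Suc n)
  have d: "(f \<circ> g has_real_derivative deriv f (g x) * deriv g x) (at x)" for x
    using Suc.prems by (intro DERIV_chain has_deriv) (auto simp: diff_upto_Suc)
  have e: "deriv (f \<circ> g) = (\<lambda>x. (deriv f \<circ> g) x * deriv g x)"
    by (rule ext) (simp add: DERIV_imp_deriv[OF d])
  have "diff_upto n g" "diff_upto n (deriv f)" "diff_upto n (deriv g)"
    using Suc.prems diff_upto_mono[of "Suc n" _ n] by (auto simp: diff_upto_Suc)
  then have "diff_upto n (deriv (f \<circ> g))"
    unfolding e by (intro diff_upto_mult Suc.IH)
  then show ?case
    using d unfolding diff_upto_Suc real_differentiable_def by blast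
qed simp

lemma smooth_comp: "smooth f \<Longrightarrow> smooth g \<Longrightarrow> smooth (f \<circ> g)"
  by (simp add: smooth_iff_diff_upto diff_upto_comp)

lemma diff_upto_const: "diff_upto n (\<lambda>x. c)"
  by (induction n arbitrary: c) (simp_all add: diff_upto_Suc)

lemma smooth_id: "smooth id"
proof -
  have "diff_upto n id" for n
  proof (cases n)
    case (Suc m)
    then show ?thesis
      using diff_upto_const[of m 1] by (simp add: diff_upto_Suc id_def)
  qed simp
  then show ?thesis by (simp add: smooth_iff_diff_upto)
qed

lemma smooth_differentiable: "smooth f \<Longrightarrow> f differentiable (at x)"
  unfolding smooth_def by (metis funpow_0)

definition Diff_R :: "(real \<Rightarrow> real) monoid" where
  "Diff_R =
    \<lparr>carrier = {f. bij f \<and> smooth f \<and> smooth (inv_into UNIV f) \<and> (\<forall>x. 0 < deriv f x)},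
     mult = (\<circ>), one = id\<rparr>"

lemma group_Diff_R: "group Diff_R"
proof (rule groupI)
  fix f g assume f: "f \<in> carrier Diff_R" and g: "g \<in> carrier Diff_R"
  have "(f \<circ> g has_real_derivative deriv f (g x) * deriv g x) (at x)" for x
    using f g by (intro DERIV_chain has_deriv) (auto simp: Diff_R_def smooth_differentiable)
  then have "deriv (f \<circ> g) x = deriv f (g x) * deriv g x" for x
    by (rule DERIV_imp_deriv)
  with f g show "f \<otimes>\<^bsub>Diff_R\<^esub> g \<in> carrier Diff_R"
    by (auto simp: Diff_R_def smooth_comp bij_comp o_inv_distrib)
next
  show "\<one>\<^bsub>Diff_R\<^esub> \<in> carrier Diff_R"
    by (auto simp: Diff_R_def smooth_id)
next
  fix f assume f: "f \<in> carrier Diff_R"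
  let ?h = "inv_into UNIV f"
  from f have b: "bij f" and s: "smooth f" "smooth ?h" and p: "\<And>x. 0 < deriv f x"
    by (auto simp: Diff_R_def)
  have "0 < deriv ?h x" for x
  proof -
    have "(f \<circ> ?h has_real_derivative deriv f (?h x) * deriv ?h x) (at x)"
      using s by (intro DERIV_chain has_deriv) (auto simp: smooth_differentiable)
    moreover have "f \<circ> ?h = (\<lambda>x. x)"
      using b by (auto simp: fun_eq_iff bij_is_surj surj_f_inv_f)
    ultimately have "deriv f (?h x) * deriv ?h x = 1"
      by (metis DERIV_ident DERIV_unique)
    then show ?thesis
      using p[of "?h x"] by (metis zero_less_mult_pos zero_less_one)
  qed
  then have "?h \<in> carrier Diff_R"
    using b s by (auto simp: Diff_R_def bij_imp_bij_inv inv_inv_eq)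
  moreover have "?h \<otimes>\<^bsub>Diff_R\<^esub> f = \<one>\<^bsub>Diff_R\<^esub>"
    using b by (simp add: Diff_R_def bij_is_inj)
  ultimately show "\<exists>h\<in>carrier Diff_R. h \<otimes>\<^bsub>Diff_R\<^esub> f = \<one>\<^bsub>Diff_R\<^esub>" by blast
qed (auto simp: Diff_R_def)

text \<open>The indexing starts at 0, with the whole group as zeroth term, so that the nilpotency class
  is the least index at which the series is trivial: the trivial group has class 0,
  nontrivial abelian groups have class 1.\<close>

primrec lower_central :: "('a, 'b) monoid_scheme \<Rightarrow> nat \<Rightarrow> 'a set" where
  "lower_central G 0 = carrier G"
| "lower_central G (Suc k) =
     generate G (\<Union>x\<in>lower_central G k. \<Union>y\<in>carrier G.
       {x \<otimes>\<^bsub>G\<^esub> y \<otimes>\<^bsub>G\<^esub> inv\<^bsub>G\<^esub> x \<otimes>\<^bsub>G\<^esub> inv\<^bsub>G\<^esub> y})"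

definition nilpotent :: "('a, 'b) monoid_scheme \<Rightarrow> bool" where
  "nilpotent G \<longleftrightarrow> (\<exists>k. lower_central G k = {\<one>\<^bsub>G\<^esub>})"

text \<open>Meaningful only for nilpotent groups.\<close>

definition nilpotency_class :: "('a, 'b) monoid_scheme \<Rightarrow> nat" where
  "nilpotency_class G = (LEAST k. lower_central G k = {\<one>\<^bsub>G\<^esub>})"

end

theory Submission
  imports Defs
begin

text \<open>Fix a diffeomorphism \<open>f\<close> of \<open>\<real>\<close> that is the identity outside \<open>(1/4, 3/4)\<close> but not at
  \<open>1/2\<close>. An integer sequence \<open>p\<close> gives the diffeomorphism that acts on each interval \<open>[k, k + 1]\<close> as
  the translate of \<open>f\<close> iterated \<open>p k\<close> times; it is smooth because it is the identity near the integers.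
  Conjugation by the translation \<open>x + 1\<close> shifts \<open>p\<close>, so commutators with it take differences of \<open>p\<close>.
  The translations by integers together with the sequences whose \<open>n\<close>-th difference vanishes
  therefore form a group whose lower central series loses one difference order in each step.\<close>

section \<open>Smooth functions on the line\<close>

lemma smoothD: "smooth f \<Longrightarrow> diff_upto n f"
  by (simp add: smooth_iff_diff_upto)

lemma smoothI: "(\<And>n. diff_upto n f) \<Longrightarrow> smooth f"
  by (simp add: smooth_iff_diff_upto)

lemma has_real_derivative_deriv: "smooth f \<Longrightarrow> (f has_real_derivative deriv f x) (at x)"
  by (intro has_deriv smooth_differentiable)

lemma diff_upto_SucI:
  assumes "\<And>x. (f has_real_derivative f' x) (at x)" "diff_upto n f'"
  shows "diff_upto (Suc n) f"
proof -
  have "deriv f = f'"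
    by (rule ext) (rule DERIV_imp_deriv[OF assms(1)])
  then show ?thesis
    using assms by (auto simp: diff_upto_Suc real_differentiable_def)
qed

lemma smooth_add: "smooth f \<Longrightarrow> smooth g \<Longrightarrow> smooth (\<lambda>x. f x + g x)"
  by (simp add: smooth_iff_diff_upto diff_upto_add)

lemma smooth_mult: "smooth f \<Longrightarrow> smooth g \<Longrightarrow> smooth (\<lambda>x. f x * g x)"
  by (simp add: smooth_iff_diff_upto diff_upto_mult)

lemma smooth_const: "smooth (\<lambda>x. c)"
  by (simp add: smooth_iff_diff_upto diff_upto_const)

lemma smooth_ident: "smooth (\<lambda>x. x)"
  using smooth_id by (simp add: id_def)

lemma smooth_affine: "smooth (\<lambda>x. a * x + b)"
  by (intro smooth_add smooth_mult smooth_const smooth_ident)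

lemma smooth_compose: "smooth f \<Longrightarrow> smooth g \<Longrightarrow> smooth (\<lambda>x. f (g x))"
  using smooth_comp[of f g] by (simp add: comp_def)

lemma diff_upto_inverse:
  assumes "diff_upto n f" "\<And>x. f x \<noteq> 0"
  shows "diff_upto n (\<lambda>x. inverse (f x))"
  using assms
proof (induction n)
  case (Suc n)
  have "((\<lambda>x. inverse (f x)) has_real_derivative
      - 1 * (inverse (f x) * deriv f x * inverse (f x))) (at x)" for x
    using Suc.prems DERIV_inverse'[OF has_deriv, of f x] by (simp add: diff_upto_Suc)
  moreover have "diff_upto n f" "diff_upto n (deriv f)"
    using Suc.prems diff_upto_mono[of "Suc n" f n] by (auto simp: diff_upto_Suc)
  ultimately show ?case
    using Suc.IH Suc.prems(2) by (intro diff_upto_SucI[of _ "\<lambda>x. - 1 * (inverse (f x) * deriv f x * inverse (f x))"]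
        diff_upto_mult diff_upto_const) auto
qed simp

text \<open>A bootstrap: the inverse function theorem gives the derivative of the inverse
  \<open>?h\<close> as the reciprocal of \<open>deriv f\<close> composed with \<open>?h\<close>. If
  \<open>?h\<close> is differentiable up to order \<open>n\<close>, so is this expression, and
  \<open>?h\<close> gains one order.\<close>

lemma smooth_inv_into:
  assumes f: "smooth f" "bij f" "\<And>x. 0 < deriv f x"
  shows "smooth (inv_into UNIV f)"
proof (rule smoothI)
  let ?h = "inv_into UNIV f"
  have d: "(?h has_real_derivative inverse (deriv f (?h y))) (at y)" for y
  proof -
    have "deriv f (?h y) \<noteq> 0"
      using f(3)[of "?h y"] by simp
    then have "(*) (deriv f (?h y)) \<circ> (*) (inverse (deriv f (?h y))) = id"
      by (auto simp: fun_eq_iff)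
    moreover have "continuous_on UNIV f"
      by (meson DERIV_isCont continuous_at_imp_continuous_on f(1) has_real_derivative_deriv)
    ultimately show ?thesis
      using f has_real_derivative_deriv[OF f(1), of "?h y"] unfolding has_field_derivative_def
      by (intro has_derivative_inverse_strong_x[of UNIV ?h y f "(*) (deriv f (?h y))"])
        (simp_all add: bij_is_inj bij_is_surj surj_f_inv_f)
  qed
  fix n
  show "diff_upto n ?h"
  proof (induction n)
    case (Suc n)
    have "diff_upto n (deriv f)"
      using smoothD[OF f(1), of "Suc n"] by (simp add: diff_upto_Suc)
    then have "diff_upto n (\<lambda>y. deriv f (?h y))"
      using diff_upto_comp[OF _ Suc, of "deriv f"] by (simp add: comp_def)
    then show ?case
      using f(3) by (intro diff_upto_SucI[OF d] diff_upto_inverse) (auto simp: less_imp_neq[symmetric])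
  qed simp
qed

lemma higher_deriv_cong_open:
  assumes "open S" "\<And>x. x \<in> S \<Longrightarrow> f x = h x" "x \<in> S"
  shows "(deriv ^^ k) f x = (deriv ^^ k) h x"
  using assms(3)
proof (induction k arbitrary: x)
  case (Suc k)
  have "eventually (\<lambda>y. (deriv ^^ k) f y = (deriv ^^ k) h y) (nhds x)"
    using Suc assms(1) by (auto simp: eventually_nhds)
  then show ?case
    by (simp add: deriv_cong_ev)
qed (use assms in simp)

text \<open>Near \<open>x\<close> every iterated derivative of \<open>f\<close> agrees with that of
  the local model \<open>h\<close>, because differentiation depends only on values in an open
  neighbourhood.\<close>

lemma smooth_local:
  assumes "\<And>x. \<exists>S h. open S \<and> x \<in> S \<and> smooth h \<and> (\<forall>y\<in>S. f y = h y)"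
  shows "smooth f"
  unfolding smooth_def
proof (intro allI)
  fix k x
  obtain S h where S: "open S" "x \<in> S" "smooth h" "\<And>y. y \<in> S \<Longrightarrow> f y = h y"
    using assms by meson
  have "((deriv ^^ k) h has_real_derivative deriv ((deriv ^^ k) h) x) (at x)"
    using S(3) by (intro has_deriv) (simp add: smooth_def)
  then have "((deriv ^^ k) f has_real_derivative deriv ((deriv ^^ k) h) x) (at x)"
    using has_field_derivative_transform_within_open S higher_deriv_cong_open[of S f h _ k]
    by (smt (verit, best))
  then show "(deriv ^^ k) f differentiable at x"
    by (auto simp: real_differentiable_def)
qed

section \<open>A compactly supported diffeomorphism\<close>

text \<open>The case \<open>m = 0\<close> is the classical flat function exp(-1/x), extended by 0.
  The powers of 1/x make the linear span of the family closed under differentiation.\<close>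

definition flat_exp :: "nat \<Rightarrow> real \<Rightarrow> real" where
  "flat_exp m x = (if 0 < x then inverse x ^ m * exp (- inverse x) else 0)"

lemma flat_exp_limit: "(flat_exp m \<longlongrightarrow> 0) (at_right 0)"
proof -
  have "((\<lambda>x. inverse x ^ m / exp (inverse x)) \<longlongrightarrow> 0) (at_right (0::real))"
    by (rule filterlim_compose[OF tendsto_power_div_exp_0 filterlim_inverse_at_top_right])
  moreover have "eventually (\<lambda>x. inverse x ^ m / exp (inverse x) = flat_exp m x) (at_right 0)"
    by (auto simp: eventually_at_filter flat_exp_def exp_minus divide_inverse)
  ultimately show ?thesis
    by (rule Lim_transform_eventually)
qed

lemma flat_exp_deriv:
  "(flat_exp m has_real_derivative - real m * flat_exp (Suc m) x + flat_exp (m + 2) x) (at x)"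
proof (cases x "0 :: real" rule: linorder_cases)
  case less
  have "(flat_exp m has_real_derivative 0) (at x)"
    by (rule has_field_derivative_transform_within_open[of "\<lambda>_. 0" _ _ "{..<0}"])
      (use less in \<open>auto simp: flat_exp_def\<close>)
  then show ?thesis
    using less by (simp add: flat_exp_def)
next
  case equal
  \<comment> \<open>For positive \<open>h\<close> the difference quotient at 0 is exactly
    \<open>flat_exp (Suc m) h\<close>, so its limit is already known.\<close>
  have "((\<lambda>h. (flat_exp m (0 + h) - flat_exp m 0) / h) \<longlongrightarrow> 0) (at_right 0)"
    by (rule Lim_transform_eventually[OF flat_exp_limit[of "Suc m"]])
      (auto simp: eventually_at_filter flat_exp_def field_simps)
  moreover have "((\<lambda>h. (flat_exp m (0 + h) - flat_exp m 0) / h) \<longlongrightarrow> 0) (at_left 0)"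
    by (rule Lim_transform_eventually[of "\<lambda>_. 0"])
      (auto simp: eventually_at_filter flat_exp_def)
  ultimately have "(flat_exp m has_real_derivative 0) (at 0)"
    unfolding DERIV_def by (simp add: filterlim_at_split)
  then show ?thesis
    using equal by (simp add: flat_exp_def)
next
  case greater
  have "((\<lambda>x. inverse x ^ m * exp (- inverse x)) has_real_derivative
      - real m * flat_exp (Suc m) x + flat_exp (m + 2) x) (at x)"
    using greater
    by (cases m)
      (auto intro!: derivative_eq_intros simp: flat_exp_def power2_eq_square algebra_simps,
        metis Suc_pred neq0_conv power_Suc)
  then show ?thesis
    by (rule has_field_derivative_transform_within_open[of _ _ _ "{0<..}"])
      (use greater in \<open>auto simp: flat_exp_def\<close>)
qed

lemma smooth_flat_exp: "smooth (flat_exp m)"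
proof (rule smoothI)
  show "diff_upto n (flat_exp m)" for n
  proof (induction n arbitrary: m)
    case (Suc n)
    then show ?case
      by (intro diff_upto_SucI[OF flat_exp_deriv] diff_upto_add diff_upto_mult diff_upto_const)
  qed simp
qed

section \<open>A bump function and a small perturbation of the identity\<close>

definition bump :: "real \<Rightarrow> real" where
  "bump x = flat_exp 0 (x - 1/4) * flat_exp 0 (3/4 - x)"

lemma smooth_bump: "smooth bump"
  unfolding bump_def[abs_def]
  using smooth_affine[of 1 "- 1/4"] smooth_affine[of "- 1" "3/4"]
  by (intro smooth_mult smooth_compose[OF smooth_flat_exp]) simp_all

lemma bump_eq_0: "x \<le> 1/4 \<or> 3/4 \<le> x \<Longrightarrow> bump x = 0"
  by (auto simp: bump_def flat_exp_def)

lemma bump_half: "bump (1/2) \<noteq> 0"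
  by (simp add: bump_def flat_exp_def)

lemma deriv_bump_bounded: "\<exists>B>0. \<forall>x. \<bar>deriv bump x\<bar> \<le> B"
proof -
  \<comment> \<open>Order two makes \<open>deriv bump\<close> itself differentiable, hence
    continuous and bounded on the compact interval; outside it the derivative is zero.\<close>
  have "diff_upto (Suc (Suc 0)) bump"
    by (rule smoothD[OF smooth_bump])
  then have "continuous_on {0..1} (deriv bump)"
    by (auto simp: diff_upto_Suc intro!: continuous_at_imp_continuous_on differentiable_imp_continuous_within)
  then have "bounded (deriv bump ` {0..1})"
    by (intro compact_imp_bounded compact_continuous_image) auto
  then obtain B where B: "B > 0" "\<And>x. 0 \<le> x \<Longrightarrow> x \<le> 1 \<Longrightarrow> \<bar>deriv bump x\<bar> \<le> B"
    by (auto simp: bounded_pos)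
  have "deriv bump x = 0" if "x < 0 \<or> 1 < x" for x
    using higher_deriv_cong_open[of "- {0..1}" bump "\<lambda>_. 0" x 1] that
    by (fastforce simp: bump_eq_0 open_Compl)
  with B show ?thesis
    by (metis abs_zero less_imp_le not_le)
qed

lemma Diff_R_I: "bij f \<Longrightarrow> smooth f \<Longrightarrow> (\<And>x. 0 < deriv f x) \<Longrightarrow> f \<in> carrier Diff_R"
  by (simp add: Diff_R_def smooth_inv_into)

lemma Diff_R_D:
  assumes "f \<in> carrier Diff_R"
  shows "bij f" "smooth f" "0 < deriv f x"
  using assms by (auto simp: Diff_R_def)

lemma Diff_R_simps [simp]: "f \<otimes>\<^bsub>Diff_R\<^esub> h = f \<circ> h" "\<one>\<^bsub>Diff_R\<^esub> = id"
  by (simp_all add: Diff_R_def)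

lemma deriv_pos_imp_strict_mono:
  assumes "smooth f" "\<And>x. 0 < deriv f x"
  shows "strict_mono f"
proof (rule strict_monoI)
  fix a b :: real
  assume "a < b"
  then show "f a < f b"
    by (rule DERIV_pos_imp_increasing) (use has_real_derivative_deriv assms in blast)
qed

lemma ex_supported_diffeo:
  "\<exists>f\<in>carrier Diff_R. f (1/2) \<noteq> 1/2 \<and> (\<forall>x. x \<le> 1/4 \<or> 3/4 \<le> x \<longrightarrow> f x = x)"
proof -
  obtain B where B: "B > 0" "\<And>x. \<bar>deriv bump x\<bar> \<le> B"
    using deriv_bump_bounded by blast
  \<comment> \<open>This factor keeps the absolute value of \<open>c * deriv bump x\<close> below 1,
    so the derivative of \<open>f\<close> stays positive.\<close>
  define c where "c = 1 / (B + 1)"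
  define f where "f x = x + c * bump x" for x
  have s: "smooth f"
    unfolding f_def[abs_def]
    by (intro smooth_add smooth_mult smooth_ident smooth_const smooth_bump)
  have "(f has_real_derivative 1 + c * deriv bump x) (at x)" for x
    unfolding f_def[abs_def]
    by (auto intro!: derivative_eq_intros has_real_derivative_deriv smooth_bump)
  then have d: "deriv f x = 1 + c * deriv bump x" for x
    by (rule DERIV_imp_deriv)
  have pos: "0 < deriv f x" for x
    using B(1) B(2)[of x] unfolding d c_def by (auto simp: field_simps)
  have fixed: "f x = x" if "x \<le> 1/4 \<or> 3/4 \<le> x" for x
    using that by (simp add: f_def bump_eq_0)
  have "\<exists>x. f x = y" for y
  proof (cases "0 \<le> y \<and> y \<le> 1")
    case True
    moreover have "continuous_on {0..1} f"
      by (meson DERIV_isCont continuous_at_imp_continuous_on s has_real_derivative_deriv)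
    ultimately show ?thesis
      using IVT'[of f 0 y 1] fixed[of 0] fixed[of 1] by auto
  qed (auto intro!: exI[of _ y] fixed)
  then have "surj f"
    by (metis surjI)
  moreover have "inj f"
    using deriv_pos_imp_strict_mono[OF s pos] by (rule strict_mono_imp_inj_on)
  ultimately have "f \<in> carrier Diff_R"
    using s pos by (intro Diff_R_I) (auto simp: bij_def)
  moreover have "f (1/2) \<noteq> 1/2"
    using bump_half B(1) by (simp add: f_def c_def)
  ultimately show ?thesis
    using fixed by blast
qed

text \<open>\<open>g i\<close> plays the role of the \<open>i\<close>-th iterate of one
  diffeomorphism, negative \<open>i\<close> included. The margins of width 1/4 at both ends of the
  unit interval allow translated copies to be glued smoothly.\<close>

locale supported_action =
  fixes g :: "int \<Rightarrow> real \<Rightarrow> real"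
  assumes diffeo: "g i \<in> carrier Diff_R"
    and add: "g (i + j) x = g i (g j x)"
    and fixed: "x \<le> 1/4 \<or> 3/4 \<le> x \<Longrightarrow> g i x = x"
    and nontrivial: "g 1 (1/2) \<noteq> 1/2"

lemma ex_supported_action: "\<exists>g. supported_action g"
proof -
  interpret group Diff_R by (rule group_Diff_R)
  obtain f where f: "f \<in> carrier Diff_R" "f (1/2) \<noteq> 1/2"
      "\<And>x. x \<le> 1/4 \<or> 3/4 \<le> x \<Longrightarrow> f x = x"
    using ex_supported_diffeo by blast
  let ?S = "{h \<in> carrier Diff_R. \<forall>x. x \<le> 1/4 \<or> 3/4 \<le> x \<longrightarrow> h x = x}"
  \<comment> \<open>Diffeomorphisms with the prescribed fixed points form a subgroup, so all integer
    powers of \<open>f\<close> keep them.\<close>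
  have "subgroup ?S Diff_R"
  proof (rule subgroupI)
    fix h assume h: "h \<in> ?S"
    then have "inv\<^bsub>Diff_R\<^esub> h \<circ> h = id"
      using l_inv[of h] by simp
    with h show "inv\<^bsub>Diff_R\<^esub> h \<in> ?S"
      by (auto simp: fun_eq_iff) (metis, metis)
  qed (use one_closed m_closed f in auto)
  then have "f [^]\<^bsub>Diff_R\<^esub> (i::int) \<in> ?S" for i
    using f by (intro subgroup_int_pow_closed) auto
  then have "supported_action (\<lambda>i. f [^]\<^bsub>Diff_R\<^esub> (i::int))"
    using f by unfold_locales (auto simp: int_pow_mult)
  then show ?thesis
    by (rule exI[of supported_action])
qed

section \<open>Twisting the unit intervals\<close>

context supported_action
begin

lemma zero [simp]: "g 0 x = x"
  using add[of 0 0 x] Diff_R_D(1)[OF diffeo[of 0]] by (simp add: bij_def inj_eq)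

lemma strict_mono_action: "strict_mono (g i)"
  by (intro deriv_pos_imp_strict_mono Diff_R_D[OF diffeo])

text \<open>The map \<open>g i\<close> is increasing and fixes 0 and 1.\<close>

lemma unit_interval: "0 \<le> x \<Longrightarrow> x < 1 \<Longrightarrow> 0 \<le> g i x \<and> g i x < 1"
  using strict_mono_less_eq[OF strict_mono_action, of i 0 x]
    strict_mono_less[OF strict_mono_action, of i x 1] by (simp add: fixed)

text \<open>The pair \<open>(m, p)\<close> is an element of the semidirect product of the integers with the integer
  sequences on which they act by shifts; see \<open>twist_comp\<close>.\<close>

definition twist :: "int \<Rightarrow> (int \<Rightarrow> int) \<Rightarrow> real \<Rightarrow> real" where
  "twist m p x = of_int \<lfloor>x\<rfloor> + g (p \<lfloor>x\<rfloor>) (x - of_int \<lfloor>x\<rfloor>) + of_int m"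

lemma floor_twist: "\<lfloor>twist m p x\<rfloor> = \<lfloor>x\<rfloor> + m"
proof -
  have "0 \<le> g (p \<lfloor>x\<rfloor>) (x - of_int \<lfloor>x\<rfloor>) \<and> g (p \<lfloor>x\<rfloor>) (x - of_int \<lfloor>x\<rfloor>) < 1"
    by (rule unit_interval) linarith+
  then show ?thesis
    unfolding twist_def by linarith
qed

text \<open>The right factor acts first and moves interval \<open>k\<close> to \<open>k + l\<close>.
  There \<open>p\<close> is read at \<open>k + l\<close>, and the two exponents add by the action
  law.\<close>

lemma twist_comp: "twist m p \<circ> twist l q = twist (m + l) (\<lambda>k. p (k + l) + q k)"
proof
  fix x
  have "twist l q x - of_int (\<lfloor>x\<rfloor> + l) = g (q \<lfloor>x\<rfloor>) (x - of_int \<lfloor>x\<rfloor>)"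
    by (simp add: twist_def)
  then show "(twist m p \<circ> twist l q) x = twist (m + l) (\<lambda>k. p (k + l) + q k) x"
    by (simp add: twist_def[of m] floor_twist) (simp add: twist_def add)
qed

lemma twist_id: "twist 0 (\<lambda>_. 0) = id"
  by (auto simp: twist_def)

lemma twist_inverse:
  "twist m p \<circ> twist (- m) (\<lambda>k. - p (k - m)) = id"
  "twist (- m) (\<lambda>k. - p (k - m)) \<circ> twist m p = id"
  by (simp_all add: twist_comp twist_id)

text \<open>In the two margins beyond the \<open>j\<close>-th unit interval, both sides are just
  translation by \<open>m\<close>, since \<open>g\<close> fixes the points involved. One formula is
  thus valid on an open set containing the closed interval, which yields smoothness at the
  integers.\<close>

lemma twist_local:
  assumes "of_int j - 1/4 < x" "x < of_int j + 5/4"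
  shows "twist m p x = g (p j) (x - of_int j) + of_int (j + m)"
proof -
  consider "\<lfloor>x\<rfloor> = j" | "\<lfloor>x\<rfloor> = j - 1" | "\<lfloor>x\<rfloor> = j + 1"
    using assms by linarith
  then show ?thesis
  proof cases
    case 1
    then show ?thesis by (simp add: twist_def)
  next
    case 2
    then have "x < of_int j" by linarith
    then show ?thesis using 2 assms by (simp add: twist_def fixed)
  next
    case 3
    then have "of_int j + 1 \<le> x" by linarith
    then show ?thesis using 3 assms by (simp add: twist_def fixed)
  qed
qed

lemma twist_Diff_R: "twist m p \<in> carrier Diff_R"
proof (rule Diff_R_I)
  show "bij (twist m p)"
    by (rule o_bij[OF twist_inverse(2) twist_inverse(1)])
  define U :: "real \<Rightarrow> real set" where "U x = {of_int \<lfloor>x\<rfloor> - 1/4 <..< of_int \<lfloor>x\<rfloor> + 5/4}" for x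
  define h where "h x y = g (p \<lfloor>x\<rfloor>) (y - of_int \<lfloor>x\<rfloor>) + of_int (\<lfloor>x\<rfloor> + m)" for x y :: real
  have U: "open (U x)" "x \<in> U x" for x
    unfolding U_def greaterThanLessThan_iff by (simp, linarith)
  have eq: "twist m p y = h x y" if "y \<in> U x" for x y
    using that unfolding U_def h_def by (intro twist_local) auto
  have "smooth (\<lambda>y. y - of_int \<lfloor>x\<rfloor>)" for x :: real
    using smooth_add[OF smooth_ident smooth_const[of "- of_int \<lfloor>x\<rfloor>"]] by simp
  then have "smooth (h x)" for x
    unfolding h_def[abs_def]
    by (intro smooth_add[OF _ smooth_const] smooth_compose[OF Diff_R_D(2)[OF diffeo]])
  then show "smooth (twist m p)"
    using U eq by (intro smooth_local) meson
  fix x :: real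
  let ?y = "x - of_int \<lfloor>x\<rfloor>"
  have "((\<lambda>y. y - of_int \<lfloor>x\<rfloor>) has_real_derivative 1) (at x)"
    by (auto intro!: derivative_eq_intros)
  from DERIV_add[OF DERIV_chain2[OF has_real_derivative_deriv[OF Diff_R_D(2)[OF diffeo]] this] DERIV_const]
  have "(h x has_real_derivative deriv (g (p \<lfloor>x\<rfloor>)) ?y * 1) (at x)"
    unfolding h_def by simp
  then have "(twist m p has_real_derivative deriv (g (p \<lfloor>x\<rfloor>)) ?y * 1) (at x)"
    by (rule has_field_derivative_transform_within_open[OF _ U(1)[of x] U(2)]) (simp add: eq)
  then show "0 < deriv (twist m p) x"
    using Diff_R_D(3)[OF diffeo] by (simp add: DERIV_imp_deriv)
qed

lemma twist_nontrivial: "p 0 = 1 \<Longrightarrow> twist 0 p \<noteq> id"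
  using nontrivial by (auto simp: twist_def fun_eq_iff intro!: exI[of _ "1/2"])

end

section \<open>Iterated differences\<close>

text \<open>For integer values these are the integer-valued polynomials of degree less than
  \<open>d\<close>. Backward differences match the shifts \<open>k - m\<close> that occur in
  inverses and commutators of twists.\<close>

primrec vanishing_diff :: "nat \<Rightarrow> (int \<Rightarrow> 'a::ab_group_add) \<Rightarrow> bool" where
  "vanishing_diff 0 p \<longleftrightarrow> (\<forall>k. p k = 0)"
| "vanishing_diff (Suc d) p \<longleftrightarrow> vanishing_diff d (\<lambda>k. p k - p (k - 1))"

lemma vanishing_diff_zero: "vanishing_diff d (\<lambda>_. 0)"
  by (induction d) auto

lemma vanishing_diff_add:
  "vanishing_diff d p \<Longrightarrow> vanishing_diff d q \<Longrightarrow> vanishing_diff d (\<lambda>k. p k + q k)"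
proof (induction d arbitrary: p q)
  case (Suc d)
  then have "vanishing_diff d (\<lambda>k. (p k - p (k - 1)) + (q k - q (k - 1)))"
    by simp
  then show ?case
    by (simp add: algebra_simps)
qed simp

lemma vanishing_diff_uminus: "vanishing_diff d p \<Longrightarrow> vanishing_diff d (\<lambda>k. - p k)"
proof (induction d arbitrary: p)
  case (Suc d)
  then have "vanishing_diff d (\<lambda>k. - (p k - p (k - 1)))"
    by (simp only: vanishing_diff.simps)
  then show ?case
    by (simp add: algebra_simps)
qed simp

lemma vanishing_diff_minus:
  "vanishing_diff d p \<Longrightarrow> vanishing_diff d q \<Longrightarrow> vanishing_diff d (\<lambda>k. p k - q k)"
  using vanishing_diff_add[of d p "\<lambda>k. - q k"] by (simp add: vanishing_diff_uminus)

lemma vanishing_diff_shift: "vanishing_diff d p \<Longrightarrow> vanishing_diff d (\<lambda>k. p (k + l))"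
proof (induction d arbitrary: p)
  case (Suc d)
  then have "vanishing_diff d (\<lambda>k. p (k + l) - p (k + l - 1))"
    by simp
  then show ?case
    by (simp add: algebra_simps)
qed simp

lemma vanishing_diff_mono:
  assumes "vanishing_diff d p" "d \<le> e"
  shows "vanishing_diff e p"
  using assms(2)
proof (induction e rule: dec_induct)
  case (step e)
  then show ?case
    using vanishing_diff_minus[OF _ vanishing_diff_shift[of e p "- 1"]] by simp
qed (rule assms)

text \<open>The difference over distance \<open>l\<close> telescopes into shifted unit differences,
  added for positive \<open>l\<close> and subtracted for negative \<open>l\<close>; each of them has
  order \<open>d\<close>.\<close>

lemma vanishing_diff_difference:
  assumes "vanishing_diff (Suc d) p"
  shows "vanishing_diff d (\<lambda>k. p k - p (k - l))"
proof (induction l rule: int_induct[where k = 0])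
  case (step1 i)
  have "vanishing_diff d (\<lambda>k. p (k + (- i)) - p (k + (- i) - 1))"
    using assms by (intro vanishing_diff_shift[of d "\<lambda>k. p k - p (k - 1)"]) simp
  from vanishing_diff_add[OF step1(2) this] show ?case
    by (simp add: algebra_simps)
next
  case (step2 i)
  have "vanishing_diff d (\<lambda>k. p (k + (1 - i)) - p (k + (1 - i) - 1))"
    using assms by (intro vanishing_diff_shift[of d "\<lambda>k. p k - p (k - 1)"]) simp
  from vanishing_diff_minus[OF step2(2) this] show ?case
    by (simp add: algebra_simps)
qed (simp add: vanishing_diff_zero)

lemma ex_antidifference:
  fixes q :: "int \<Rightarrow> 'a::ab_group_add"
  shows "\<exists>p. \<forall>k. p k - p (k - 1) = q k"
proof (intro exI allI)
  fix k :: int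
  \<comment> \<open>A two-sided indefinite sum normalised to vanish at 0: one of the two index
    intervals is always empty.\<close>
  let ?p = "\<lambda>k. sum q {1..k} - sum q {k + 1..0}"
  show "?p k - ?p (k - 1) = q k"
  proof (cases "1 \<le> k")
    case True
    then have "{1..k} = insert k {1..k - 1}" by auto
    with True show ?thesis by simp
  next
    case False
    then have "{k - 1 + 1..0} = insert k {k + 1..0}" by auto
    with False show ?thesis by simp
  qed
qed

text \<open>Analogues of the binomial polynomials, with arbitrary constants of summation:
  \<open>b d\<close> has degree exactly \<open>d\<close>. They serve as witnesses that the lower
  central series does not collapse early.\<close>

lemma ex_antidifference_sequence:
  "\<exists>b :: nat \<Rightarrow> int \<Rightarrow> int. b 0 = (\<lambda>_. 1) \<and> (\<forall>d k. b (Suc d) k - b (Suc d) (k - 1) = b d k)"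
proof -
  obtain A :: "(int \<Rightarrow> int) \<Rightarrow> int \<Rightarrow> int" where A: "\<And>q k. A q k - A q (k - 1) = q k"
    using ex_antidifference by metis
  show ?thesis
    by (rule exI[of _ "rec_nat (\<lambda>_. 1) (\<lambda>_. A)"]) (simp add: A)
qed

section \<open>The nilpotent groups\<close>

lemma commutator_in_lower_central:
  assumes "x \<in> lower_central G k" "y \<in> carrier G"
  shows "x \<otimes>\<^bsub>G\<^esub> y \<otimes>\<^bsub>G\<^esub> inv\<^bsub>G\<^esub> x \<otimes>\<^bsub>G\<^esub> inv\<^bsub>G\<^esub> y \<in> lower_central G (Suc k)"
  using assms by (auto intro!: generate.incl)

text \<open>Commutators with the identity are trivial, so a trivial term makes all later terms
  trivial. A nontrivial term therefore bounds the nilpotency class from below.\<close>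

lemma (in group) lower_central_trivial_mono:
  assumes "lower_central G k = {\<one>}" "k \<le> j"
  shows "lower_central G j = {\<one>}"
  using assms(2)
proof (induction rule: dec_induct)
  case (step j)
  have "(\<Union>x\<in>{\<one>}. \<Union>y\<in>carrier G. {x \<otimes> y \<otimes> inv x \<otimes> inv y}) = {\<one>}"
    by auto
  then show ?case
    using step generate_one by simp
qed (rule assms)

lemma (in group) lower_central_Suc_subset:
  assumes "subgroup S G"
    and "\<And>x y. x \<in> lower_central G k \<Longrightarrow> y \<in> carrier G \<Longrightarrow> x \<otimes> y \<otimes> inv x \<otimes> inv y \<in> S"
  shows "lower_central G (Suc k) \<subseteq> S"
  unfolding lower_central.simps by (rule generate_subgroup_incl) (use assms in auto)

lemma (in group) nilpotency_classI:
  assumes "lower_central G (Suc d) = {\<one>}" "lower_central G d \<noteq> {\<one>}"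
  shows "nilpotent G" "nilpotency_class G = Suc d"
proof -
  show "nilpotent G"
    unfolding nilpotent_def using assms(1) by blast
  show "nilpotency_class G = Suc d"
    unfolding nilpotency_class_def
  proof (rule Least_equality)
    fix k assume "lower_central G k = {\<one>}"
    then show "Suc d \<le> k"
      using lower_central_trivial_mono assms(2) not_less_eq_eq by blast
  qed (rule assms)
qed

section \<open>Lower central series of the groups of twists\<close>

context supported_action
begin

lemma inv_twist: "inv\<^bsub>Diff_R\<^esub> (twist m p) = twist (- m) (\<lambda>k. - p (k - m))"
  using group.inv_equality[OF group_Diff_R _ twist_Diff_R twist_Diff_R] twist_inverse(2) by simp

text \<open>The translation parts cancel because the integers commute. What remains is a difference
  of \<open>p\<close> over distance \<open>m\<close> minus one of \<open>q\<close> over distance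
  \<open>l\<close>, both shifted.\<close>

lemma commutator_twist:
  "twist l p \<circ> twist m q \<circ> inv\<^bsub>Diff_R\<^esub> (twist l p) \<circ> inv\<^bsub>Diff_R\<^esub> (twist m q) =
    twist 0 (\<lambda>k. (p (k - l) - p (k - l - m)) - (q (k - m) - q (k - m - l)))"
  by (simp add: inv_twist twist_comp algebra_simps)

text \<open>Two choices of \<open>M\<close> matter: \<open>UNIV\<close> gives the nilpotent group
  itself, and \<open>{0}\<close> gives the subgroups that bound its lower central series.\<close>

definition twists :: "int set \<Rightarrow> nat \<Rightarrow> (real \<Rightarrow> real) set" where
  "twists M d = {twist m p | m p. m \<in> M \<and> vanishing_diff d p}"

lemma twistsI: "m \<in> M \<Longrightarrow> vanishing_diff d p \<Longrightarrow> twist m p \<in> twists M d"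
  unfolding twists_def by blast

lemma twists_subgroup:
  assumes M: "0 \<in> M" "\<And>m. m \<in> M \<Longrightarrow> - m \<in> M" "\<And>l m. l \<in> M \<Longrightarrow> m \<in> M \<Longrightarrow> l + m \<in> M"
  shows "subgroup (twists M d) Diff_R"
proof (rule group.subgroupI[OF group_Diff_R])
  show "twists M d \<subseteq> carrier Diff_R"
    by (auto simp: twists_def twist_Diff_R)
  show "twists M d \<noteq> {}"
    using twistsI[OF M(1) vanishing_diff_zero] by blast
next
  fix f assume "f \<in> twists M d"
  then obtain m p where f: "f = twist m p" "m \<in> M" "vanishing_diff d p"
    by (auto simp: twists_def)
  then have "vanishing_diff d (\<lambda>k. - p (k + - m))"
    by (intro vanishing_diff_uminus vanishing_diff_shift)
  with f M show "inv\<^bsub>Diff_R\<^esub> f \<in> twists M d"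
    by (auto simp: twists_def inv_twist)
next
  fix f h assume "f \<in> twists M d" "h \<in> twists M d"
  then obtain m p l q where "f = twist m p" "m \<in> M" "vanishing_diff d p"
      "h = twist l q" "l \<in> M" "vanishing_diff d q"
    by (auto simp: twists_def)
  then show "f \<otimes>\<^bsub>Diff_R\<^esub> h \<in> twists M d"
    using M by (auto simp: twists_def twist_comp intro!: exI vanishing_diff_add vanishing_diff_shift)
qed

abbreviation polynomial_twists :: "nat \<Rightarrow> (real \<Rightarrow> real) monoid" where
  "polynomial_twists d \<equiv> Diff_R\<lparr>carrier := twists UNIV d\<rparr>"

lemma twists_UNIV_subgroup: "subgroup (twists UNIV d) Diff_R"
  by (rule twists_subgroup) auto

lemma twists_0_subgroup:
  assumes "e \<le> d"
  shows "subgroup (twists {0} e) (polynomial_twists d)"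
proof (rule group.subgroup_incl[OF group_Diff_R _ twists_UNIV_subgroup])
  show "subgroup (twists {0} e) Diff_R"
    by (rule twists_subgroup) auto
  show "twists {0} e \<subseteq> twists UNIV d"
    using assms vanishing_diff_mono unfolding twists_def by blast
qed

lemma polynomial_twists_group: "group (polynomial_twists d)"
  by (rule group.subgroup_imp_group[OF group_Diff_R twists_UNIV_subgroup])

lemma commutator_polynomial_twists:
  assumes "twist l p \<in> twists UNIV d" "twist m q \<in> twists UNIV d"
  shows "twist l p \<otimes>\<^bsub>polynomial_twists d\<^esub> twist m q
      \<otimes>\<^bsub>polynomial_twists d\<^esub> inv\<^bsub>polynomial_twists d\<^esub> (twist l p)
      \<otimes>\<^bsub>polynomial_twists d\<^esub> inv\<^bsub>polynomial_twists d\<^esub> (twist m q) =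
    twist 0 (\<lambda>k. (p (k - l) - p (k - l - m)) - (q (k - m) - q (k - m - l)))"
  using assms commutator_twist
  by (simp add: group.m_inv_consistent[OF group_Diff_R twists_UNIV_subgroup])

lemma commutator_in_twists:
  assumes "vanishing_diff e (\<lambda>k. p k - p (k - m))" "vanishing_diff e (\<lambda>k. q k - q (k - l))"
  shows "twist 0 (\<lambda>k. (p (k - l) - p (k - l - m)) - (q (k - m) - q (k - m - l))) \<in> twists {0} e"
  using vanishing_diff_minus[OF vanishing_diff_shift[OF assms(1), of "- l"]
      vanishing_diff_shift[OF assms(2), of "- m"]]
  by (auto simp: twists_def)

text \<open>The first commutators remove all translations and lower the order from
  \<open>Suc d\<close> to \<open>d\<close>. From then on \<open>x\<close> has translation part 0, so
  the difference of \<open>q\<close> vanishes and that of \<open>p\<close> loses one more order per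
  step.\<close>

lemma lower_central_subset:
  "k \<le> d \<Longrightarrow> lower_central (polynomial_twists (Suc d)) (Suc k) \<subseteq> twists {0} (d - k)"
proof (induction k)
  case 0
  show ?case
  proof (rule group.lower_central_Suc_subset[OF polynomial_twists_group])
    show "subgroup (twists {0} (d - 0)) (polynomial_twists (Suc d))"
      by (rule twists_0_subgroup) simp
    fix x y
    assume "x \<in> lower_central (polynomial_twists (Suc d)) 0" "y \<in> carrier (polynomial_twists (Suc d))"
    then obtain l p m q where "x = twist l p" "vanishing_diff (Suc d) p"
        "y = twist m q" "vanishing_diff (Suc d) q"
      by (auto simp: twists_def)
    moreover from this have "x \<in> twists UNIV (Suc d)" "y \<in> twists UNIV (Suc d)"
      by (auto simp del: vanishing_diff.simps intro: twistsI)
    ultimately show "x \<otimes>\<^bsub>polynomial_twists (Suc d)\<^esub> y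
        \<otimes>\<^bsub>polynomial_twists (Suc d)\<^esub> inv\<^bsub>polynomial_twists (Suc d)\<^esub> x
        \<otimes>\<^bsub>polynomial_twists (Suc d)\<^esub> inv\<^bsub>polynomial_twists (Suc d)\<^esub> y \<in> twists {0} (d - 0)"
      using commutator_in_twists[of d p m q l]
      by (simp only: commutator_polynomial_twists vanishing_diff_difference diff_zero)
  qed
next
  case (Suc k)
  show ?case
  proof (rule group.lower_central_Suc_subset[OF polynomial_twists_group])
    show "subgroup (twists {0} (d - Suc k)) (polynomial_twists (Suc d))"
      by (rule twists_0_subgroup) simp
    fix x y
    assume x: "x \<in> lower_central (polynomial_twists (Suc d)) (Suc k)"
      and y: "y \<in> carrier (polynomial_twists (Suc d))"
    obtain p m q where xy: "x = twist 0 p" "vanishing_diff (d - k) p"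
        "y = twist m q" "vanishing_diff (Suc d) q"
      using x y Suc by (fastforce simp: twists_def)
    have "x \<in> twists UNIV (Suc d)" "y \<in> twists UNIV (Suc d)"
      unfolding xy by (intro twistsI UNIV_I xy vanishing_diff_mono[OF xy(2)]; simp)+
    moreover have "vanishing_diff (d - Suc k) (\<lambda>k. p k - p (k - m))"
      using xy(2) Suc.prems by (intro vanishing_diff_difference) (simp add: Suc_diff_Suc)
    ultimately show "x \<otimes>\<^bsub>polynomial_twists (Suc d)\<^esub> y
        \<otimes>\<^bsub>polynomial_twists (Suc d)\<^esub> inv\<^bsub>polynomial_twists (Suc d)\<^esub> x
        \<otimes>\<^bsub>polynomial_twists (Suc d)\<^esub> inv\<^bsub>polynomial_twists (Suc d)\<^esub> y \<in> twists {0} (d - Suc k)"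
      using commutator_in_twists[of "d - Suc k" p m q 0] unfolding xy(1,3)
      by (simp only: commutator_polynomial_twists diff_zero diff_self vanishing_diff_zero)
  qed
qed

text \<open>The commutator of \<open>twist 0 (b (Suc j))\<close> with translation by 1 is
  \<open>twist 0 (b j)\<close>. Starting from \<open>b d\<close>, after \<open>d\<close> commutators
  the constant sequence 1 is reached, whose twist moves 1/2.\<close>

lemma lower_central_nontrivial: "lower_central (polynomial_twists (Suc d)) d \<noteq> {id}"
proof -
  obtain b :: "nat \<Rightarrow> int \<Rightarrow> int" where b: "b 0 = (\<lambda>_. 1)"
      "\<And>j k. b (Suc j) k - b (Suc j) (k - 1) = b j k"
    using ex_antidifference_sequence by blast
  have vanish: "vanishing_diff (Suc j) (b j)" for j
    by (induction j) (simp_all add: b)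
  have "twist 0 (b (d - k)) \<in> lower_central (polynomial_twists (Suc d)) k" if "k \<le> d" for k
    using that
  proof (induction k)
    case 0
    show ?case
      using twistsI[OF UNIV_I vanish] by simp
  next
    case (Suc k)
    let ?t = "twist 1 (\<lambda>_. 0)"
    have j: "d - k = Suc (d - Suc k)"
      using Suc.prems by simp
    have t: "?t \<in> twists UNIV (Suc d)"
      by (rule twistsI[OF UNIV_I vanishing_diff_zero])
    have b': "twist 0 (b (d - k)) \<in> twists UNIV (Suc d)"
      by (rule twistsI[OF UNIV_I vanishing_diff_mono[OF vanish]]) simp
    show ?case
      using commutator_in_lower_central[OF Suc.IH, of ?t] Suc.prems t
      unfolding commutator_polynomial_twists[OF b' t] by (simp add: j b)
  qed
  from this[of d] show ?thesis
    using twist_nontrivial[of "b 0"] b by auto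
qed

end

theorem theorem1p3:
  fixes n :: nat
  assumes "n \<ge> 1"
  shows "\<exists>H. subgroup H Diff_R \<and> nilpotent (Diff_R\<lparr>carrier := H\<rparr>) \<and>
    nilpotency_class (Diff_R\<lparr>carrier := H\<rparr>) = n"
proof -
  obtain g where "supported_action g"
    using ex_supported_action by blast
  then interpret supported_action g .
  \<comment> \<open>The group uses sequences with vanishing \<open>n\<close>-th difference. For
    \<open>n = 1\<close> they are constant and the group is abelian, in accordance with class
    1.\<close>
  obtain d where n: "n = Suc d"
    using assms by (cases n) auto
  interpret K: group "polynomial_twists (Suc d)"
    by (rule polynomial_twists_group)
  \<comment> \<open>With no translation and exponent 0 on every interval, only the identity is
    left.\<close>
  have "twists {0} 0 \<subseteq> {id}"
    by (auto simp: twists_def twist_def)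
  then have "lower_central (polynomial_twists (Suc d)) (Suc d) \<subseteq> {id}"
    using lower_central_subset[of d d] by (simp del: lower_central.simps)
  moreover have "id \<in> lower_central (polynomial_twists (Suc d)) (Suc d)"
    using generate.one[of "polynomial_twists (Suc d)"] by simp
  ultimately have "lower_central (polynomial_twists (Suc d)) (Suc d) = {id}"
    by blast
  then show ?thesis
    using K.nilpotency_classI[of d] lower_central_nontrivial twists_UNIV_subgroup n by auto
qed

end
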